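(* Let $Q_0(x)=x^3+ax+b$, $\Delta=4a^3+27b^2\ne0$, $E_{a,b}:y^2=Q_0(x)$, and let $Z_4(\gamma)=\oint_\gamma s_4\,dx$ be the fourth-order quantum period. Then for every $\gamma\in H_1(E_{a,b},\mathbb{Z})$, $$Z_4(\gamma)=\alpha\,A(\gamma)+\beta\,B(\gamma),\qquad A(\gamma)=\oint_\gamma\frac{dx}{y},\quad B(\gamma)=\oint_\gamma\frac{x\,dx}{y},$$ with $$\Delta^3\alpha=-\tfrac{63}{640}\,ab\,(788a^3-2457b^2),\qquad\Delta^3\beta=-\tfrac{21}{320}\,a^2(308a^3-5697b^2).$$ In particular, for $b=0$, $Z_4(\gamma)=-\tfrac{1617}{5120}\,a^{-4}B(\gamma)$.
   Context: $(a,b)\in\mathbb{C}^2$. The functions $s_k$ are defined by the formal solution $P=\sum_{k\ge0}\hbar^ks_k$ of the Riccati equation $Q_0=\hbar P'+P^2$ (prime $=d/dx$) with $s_0=\sqrt{Q_0}=y$; $s_4\,dx$ is a meromorphic form on $E_{a,b}$. *)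

theory Defs
  imports
    "HOL-Analysis.Analysis"
    "HOL-Homology.Homology"
    "HOL-Computational_Algebra.Formal_Power_Series"
begin

definition cubic :: "complex \<Rightarrow> complex \<Rightarrow> complex \<Rightarrow> complex" where
  "cubic a b x = x ^ 3 + a * x + b"

definition cubic_disc :: "complex \<Rightarrow> complex \<Rightarrow> complex" where
  "cubic_disc a b = 4 * a ^ 3 + 27 * b ^ 2"

definition affine_curve :: "complex \<Rightarrow> complex \<Rightarrow> (complex \<times> complex) set" where
  "affine_curve a b = {(x, y). y ^ 2 = cubic a b x}"

text \<open>
  The projective closure of the affine curve adds a single point at infinity (the curve is
  unibranch there), so as a topological space the compact curve is the one-point
  compactification; \<^const>\<open>None\<close> is the point at infinity.
\<close>
definition elliptic_curve :: "complex \<Rightarrow> complex \<Rightarrow> (complex \<times> complex) option topology" where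
  "elliptic_curve a b = Alexandroff_compactification (top_of_set (affine_curve a b))"

text \<open>
  The derivation \<open>d/dx\<close> on functions on the curve: the difference quotient with respect to the
  coordinate \<open>x\<close>, the limit being taken along the curve.  Where \<open>y \<noteq> 0\<close> the function \<open>x\<close> is a
  local coordinate, so this is the derivative of \<open>f (x, Y x)\<close> for the local branch
  \<open>Y\<close> of the square root of the cubic passing through the point.
\<close>
definition deriv_x :: "complex \<Rightarrow> complex \<Rightarrow> (complex \<times> complex \<Rightarrow> complex)
    \<Rightarrow> complex \<times> complex \<Rightarrow> complex" where
  "deriv_x a b f p =
     Lim (at p within affine_curve a b) (\<lambda>q. (f q - f p) / (fst q - fst p))"

text \<open>
  The power series variable is \<open>\<hbar>\<close>; the coefficients are functions on the curve, evaluated at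
  an arbitrary point off the branch points \<open>y = 0\<close>, where all coefficients beyond the zeroth
  have poles.  Comparing coefficients of \<open>\<hbar>\<close> shows that \<open>s k\<close> is determined there by
  \<open>s 0, \<dots>, s (k - 1)\<close>, so the solution exists and is unique off the branch points.
\<close>
definition riccati_solution :: "complex \<Rightarrow> complex \<Rightarrow> (nat \<Rightarrow> complex \<times> complex \<Rightarrow> complex)
    \<Rightarrow> bool" where
  "riccati_solution a b s \<longleftrightarrow>
     (\<forall>(x, y) \<in> affine_curve a b. y \<noteq> 0 \<longrightarrow>
        s 0 (x, y) = y \<and>
        fps_const (cubic a b x) =
          fps_X * Abs_fps (\<lambda>k. deriv_x a b (s k) (x, y)) + (Abs_fps (\<lambda>k. s k (x, y))) ^ 2)"

text \<open>The affine parametrisation of the standard 1-simplex, from vertex 0 to vertex 1.\<close>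
definition simplex_param :: "real \<Rightarrow> nat \<Rightarrow> real" where
  "simplex_param t = (\<lambda>i. if i = 0 then 1 - t else if i = 1 then t else 0)"

definition simplex_path :: "((nat \<Rightarrow> real) \<Rightarrow> (complex \<times> complex) option)
    \<Rightarrow> real \<Rightarrow> complex \<times> complex" where
  "simplex_path f t = the (f (simplex_param t))"

text \<open>
  Chains along which the meromorphic forms considered here can be integrated: every simplex is a
  piecewise continuously differentiable path avoiding the point at infinity and the branch
  points \<open>y = 0\<close>, where these forms may have poles.
\<close>
definition integration_chain :: "(complex \<times> complex) option chain \<Rightarrow> bool" where
  "integration_chain c \<longleftrightarrow>
     (\<forall>f \<in> Poly_Mapping.keys c.
        (\<forall>t \<in> {0..1}. f (simplex_param t) \<noteq> None \<and> snd (simplex_path f t) \<noteq> 0) \<and>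
        valid_path (simplex_path f))"

text \<open>The integral of the form \<open>F dx\<close> along a path, and along a 1-chain by linearity.\<close>
definition path_integral :: "(complex \<times> complex \<Rightarrow> complex) \<Rightarrow> (real \<Rightarrow> complex \<times> complex)
    \<Rightarrow> complex" where
  "path_integral F g =
     integral {0..1} (\<lambda>t. F (g t) * vector_derivative (fst \<circ> g) (at t within {0..1}))"

definition chain_integral :: "(complex \<times> complex \<Rightarrow> complex) \<Rightarrow> (complex \<times> complex) option chain
    \<Rightarrow> complex" where
  "chain_integral F c =
     (\<Sum>f \<in> Poly_Mapping.keys c.
        of_int (Poly_Mapping.lookup c f) * path_integral F (simplex_path f))"

text \<open>
  A class in \<^term>\<open>homology_group 1 X\<close> is a coset of the group of boundaries, that is, the set
  of all singular cycles in the class.  The integral over a class is the integral along any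
  integration chain belonging to it.
\<close>
definition representatives :: "(complex \<times> complex) option chain set
    \<Rightarrow> (complex \<times> complex) option chain set" where
  "representatives \<gamma> = {c \<in> \<gamma>. integration_chain c}"

end

(*
  On the curve the Riccati recursion gives s_k = N_k(x) / y^(3k-1) with polynomials N_k.
  The exact forms d(M(x) / y^9) suffice to reduce N_4(x) dx / y^11 to the two classes dx / y and
  x dx / y, which yields alpha and beta.  Along a path avoiding the branch points the exact part
  contributes the difference of the values of M / y^9 at the endpoints, and over a cycle these
  differences add up to zero.
*)
theory Submission
  imports Defs "HOL-Complex_Analysis.Cauchy_Integral_Theorem"
begin

text \<open>Since \<open>y\<close> is not a global function of \<open>x\<close>, differentiation and
  integrability are handled on a \<open>local_branch\<close>, near one point or one parameter at a
  time. Only \<open>M / y^9\<close> is used globally: it is single-valued on the curve off the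
  branch points, so its endpoint differences require no tracking of branches. Their cancellation is
  algebraic: the endpoint values define an additive functional on 0-chains, which is applied to the
  boundary of the cycle. That pole order 9 and degree 14 suffice for \<open>M\<close> is a count.
  Over the denominator \<open>y^11\<close> the reduction is a polynomial identity of degree 16,
  hence 17 linear equations, for the 15 coefficients of \<open>M\<close> and the two constants
  \<alpha>, \<beta>.\<close>

section \<open>The polynomial identity behind the reduction\<close>

definition fourth_numerator :: "complex \<Rightarrow> complex \<Rightarrow> complex poly" where
  "fourth_numerator a b =
    [:- 1105 * a ^ 4 - 2688 * a * b ^ 2,
      5232 * a ^ 2 * b,
      - 5340 * a ^ 3 - 19008 * b ^ 2,
      20256 * a * b,
      - 9798 * a ^ 2,
      57456 * b,
      - 924 * a,
      0,
      - 13041:]"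

text \<open>
  The polynomial \<open>M\<close> is found by comparing coefficients from the top:
  \<open>c x\<^sup>j\<close> contributes \<open>(2 j - 27) c x\<^sup>j\<^sup>+\<^sup>2\<close> as leading term of
  \<open>2 M' Q - 9 M Q'\<close>, and the factor never vanishes.
\<close>
definition exact_numerator :: "complex \<Rightarrow> complex \<Rightarrow> complex poly" where
  "exact_numerator a b =
    [:353600 * a ^ 12 + 7690320 * a ^ 9 * b ^ 2 + 59579676 * a ^ 6 * b ^ 4 + 156252159 * a ^ 3 * b ^ 6 + 182815704 * b ^ 8,
      - 1486080 * a ^ 10 * b - 27770688 * a ^ 7 * b ^ 3 - 311738544 * a ^ 4 * b ^ 5 - 378902124 * a * b ^ 7,
      1166400 * a ^ 11 + 27683856 * a ^ 8 * b ^ 2 - 21233556 * a ^ 5 * b ^ 4 + 458986419 * a ^ 2 * b ^ 6,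
      - 3352320 * a ^ 9 * b - 271234368 * a ^ 6 * b ^ 3 - 1015658352 * a ^ 3 * b ^ 5 - 1983337812 * b ^ 7,
      1391040 * a ^ 10 - 29565648 * a ^ 7 * b ^ 2 - 424771452 * a ^ 4 * b ^ 4 + 300929013 * a * b ^ 6,
      9011520 * a ^ 8 * b - 507393936 * a ^ 5 * b ^ 3 + 156110976 * a ^ 2 * b ^ 5,
      8543808 * a ^ 9 - 148378608 * a ^ 6 * b ^ 2 - 18717804 * a ^ 3 * b ^ 4 + 770058009 * b ^ 6,
      - 435456 * a ^ 7 * b - 699015744 * a ^ 4 * b ^ 3 + 169011360 * a * b ^ 5,
      14273280 * a ^ 8 - 356130432 * a ^ 5 * b ^ 2 + 49723632 * a ^ 2 * b ^ 4,
      - 21958272 * a ^ 6 * b - 414717408 * a ^ 3 * b ^ 3,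
      15966720 * a ^ 7 - 326991168 * a ^ 4 * b ^ 2 + 98712432 * a * b ^ 4,
      - 22885632 * a ^ 5 * b - 60419520 * a ^ 2 * b ^ 3,
      8692992 * a ^ 6 - 160792128 * a ^ 3 * b ^ 2,
      - 7148736 * a ^ 4 * b + 22289904 * a * b ^ 3,
      1862784 * a ^ 5 - 34455456 * a ^ 2 * b ^ 2:]"

text \<open>The fifth power enters because \<open>1 / y = Q^5 / y^11\<close> on the curve.\<close>

lemma cubic_power5:
  fixes a b :: "'a :: comm_ring_1"
  shows "[:b, a, 0, 1:] ^ 5 =
    [:b ^ 5, 5 * a * b ^ 4, 10 * a ^ 2 * b ^ 3, 10 * a ^ 3 * b ^ 2 + 5 * b ^ 4, 5 * a ^ 4 * b + 20 * a * b ^ 3,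
    a ^ 5 + 30 * a ^ 2 * b ^ 2, 20 * a ^ 3 * b + 10 * b ^ 3, 5 * a ^ 4 + 30 * a * b ^ 2, 30 * a ^ 2 * b, 10 *
    a ^ 3 + 10 * b ^ 2, 20 * a * b, 10 * a ^ 2, 5 * b, 5 * a, 0, 1:]"
proof -
  have "[:b, a, 0, 1:] ^ 2 = [:b ^ 2, 2 * a * b, a ^ 2, 2 * b, 2 * a, 0, 1:]"
    by (simp add: power2_eq_square)
  then have "[:b, a, 0, 1:] ^ 4 = [:b ^ 2, 2 * a * b, a ^ 2, 2 * b, 2 * a, 0, 1:] ^ 2"
    by (metis power_mult mult_2 numeral_Bit0)
  then have "[:b, a, 0, 1:] ^ 5 = [:b ^ 2, 2 * a * b, a ^ 2, 2 * b, 2 * a, 0, 1:] ^ 2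
      * [:b, a, 0, 1:]"
    using power_Suc2[of "[:b, a, 0, 1:]" 4] by simp
  also have "\<dots> =
    [:b ^ 5, 5 * a * b ^ 4, 10 * a ^ 2 * b ^ 3, 10 * a ^ 3 * b ^ 2 + 5 * b ^ 4, 5 * a ^ 4 * b + 20 * a * b ^ 3,
    a ^ 5 + 30 * a ^ 2 * b ^ 2, 20 * a ^ 3 * b + 10 * b ^ 3, 5 * a ^ 4 + 30 * a * b ^ 2, 30 * a ^ 2 * b, 10 *
    a ^ 3 + 10 * b ^ 2, 20 * a * b, 10 * a ^ 2, 5 * b, 5 * a, 0, 1:]"
    by (simp add: algebra_simps eval_nat_numeral)
  finally show ?thesis .
qed

text \<open>This is the reduction of \<open>s 4\<close>, multiplied by
  \<open>92160 * cubic_disc a b ^ 3 * y ^ 11\<close>, where 92160 = 45 * 2048. The factor 45 clears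
  the rational denominators in \<open>M\<close>; 9072 and 6048 are 92160 times 63/640 and 21/320.
  Degrees 16 down to 2 fix \<open>M\<close> in terms of \<alpha> and \<beta>; degrees 1 and 0 then
  pin down these two constants.\<close>

lemma exact_numerator_identity:
  "[:45 * cubic_disc a b ^ 3:] * fourth_numerator a b =
    - [:9072 * (a * b * (788 * a ^ 3 - 2457 * b ^ 2)),
        6048 * (a ^ 2 * (308 * a ^ 3 - 5697 * b ^ 2)):]
        * [:b, a, 0, 1:] ^ 5
    + 2 * pderiv (exact_numerator a b) * [:b, a, 0, 1:] - 9 * exact_numerator a b * [:a, 0, 3:]"
proof -
  have "cubic_disc a b ^ 3 = 64 * a ^ 9 + 1296 * a ^ 6 * b ^ 2 + 8748 * a ^ 3 * b ^ 4 + 19683 * b ^ 6"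
    by (simp add: cubic_disc_def algebra_simps eval_nat_numeral)
  then show ?thesis
    unfolding exact_numerator_def fourth_numerator_def cubic_power5
    by (simp add: pderiv_pCons numeral_poly algebra_simps eval_nat_numeral)
qed

section \<open>Local branches of the curve and the derivation along them\<close>

lemma cubic_has_field_derivative:
  "(cubic a b has_field_derivative 3 * x ^ 2 + a) (at x within S)"
  unfolding cubic_def by (auto intro!: derivative_eq_intros)

text \<open>Near \<open>(x0, y0)\<close> the curve is the graph of \<open>Y\<close>. The one radius
  serves both for the disc in the x-plane and for the neighbourhood in the product in which every
  curve point lies on the graph.\<close>

definition local_branch where
  "local_branch a b x0 y0 r Y \<longleftrightarrow> 0 < r \<and> Y x0 = y0
    \<and> (\<forall>x\<in>ball x0 r. (x, Y x) \<in> affine_curve a b \<and> Y x \<noteq> 0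
        \<and> (Y has_field_derivative (3 * x ^ 2 + a) / (2 * Y x)) (at x))
    \<and> (\<forall>(x, y)\<in>affine_curve a b. dist (x, y) (x0, y0) < r \<longrightarrow> y = Y x)"

lemma local_branchD:
  assumes "local_branch a b x0 y0 r Y"
  shows "0 < r" "Y x0 = y0"
    "\<And>x. x \<in> ball x0 r \<Longrightarrow> (x, Y x) \<in> affine_curve a b"
    "\<And>x. x \<in> ball x0 r \<Longrightarrow> Y x \<noteq> 0"
    "\<And>x. x \<in> ball x0 r \<Longrightarrow> (Y has_field_derivative (3 * x ^ 2 + a) / (2 * Y x)) (at x)"
    "\<And>x y. (x, y) \<in> affine_curve a b \<Longrightarrow> dist (x, y) (x0, y0) < r \<Longrightarrow> y = Y x"
  using assms unfolding local_branch_def by blast+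

lemma local_branch_exists:
  assumes p: "(x0, y0) \<in> affine_curve a b" and y0: "y0 \<noteq> 0"
  obtains r Y where "local_branch a b x0 y0 r Y"
proof -
  \<comment> \<open>Dividing by \<open>y0 ^ 2\<close> moves the value at \<open>x0\<close> to 1,
    away from the cut of \<open>csqrt\<close>, whatever \<open>y0\<close> is.\<close>
  define q where "q = (\<lambda>x. cubic a b x / y0 ^ 2)"
  define Y where "Y = (\<lambda>x. y0 * csqrt (q x))"
  have q0: "q x0 = 1"
    using p y0 by (auto simp: q_def affine_curve_def)
  have "continuous_on UNIV (\<lambda>x. Re (q x))"
    unfolding q_def cubic_def using y0 by (intro continuous_intros) auto
  then have "open {x. 0 < Re (q x)}"
    by (intro open_Collect_less continuous_on_const)
  moreover have "x0 \<in> {x. 0 < Re (q x)}"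
    using q0 by simp
  ultimately obtain r1 where r1: "r1 > 0" "ball x0 r1 \<subseteq> {x. 0 < Re (q x)}"
    using open_contains_ball by blast
  \<comment> \<open>The bound \<open>norm y0\<close> excludes the other root:
    \<open>norm (y - y0) < norm y0\<close> puts \<open>y / y0\<close> in the right half-plane, where
    it must be the principal root.\<close>
  define r where "r = min r1 (norm y0)"
  have Yder: "(Y has_field_derivative (3 * x ^ 2 + a) / (2 * Y x)) (at x)"
    if "x \<in> ball x0 r" for x
  proof -
    have pos: "0 < Re (q x)" using that r1 unfolding r_def by auto
    then have "q x \<notin> \<real>\<^sub>\<le>\<^sub>0"
      by (auto simp: complex_nonpos_Reals_iff)
    moreover have "csqrt (q x) \<noteq> 0" using pos by auto
    moreover have "(q has_field_derivative (3 * x ^ 2 + a) / y0 ^ 2) (at x)"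
      unfolding q_def using y0 by (intro DERIV_cdivide cubic_has_field_derivative)
    ultimately show ?thesis
      unfolding Y_def using y0
      by (auto intro!: derivative_eq_intros simp: field_simps power2_eq_square)
  qed
  have "local_branch a b x0 y0 r Y"
    unfolding local_branch_def
  proof (intro conjI ballI, safe)
    show "0 < r" using r1 y0 by (simp add: r_def)
    show "Y x0 = y0" by (simp add: Y_def q0)
    show "(x, Y x) \<in> affine_curve a b" for x
      using y0 by (simp add: affine_curve_def Y_def q_def power_mult_distrib)
    show False if "x \<in> ball x0 r" "Y x = 0" for x
    proof -
      have "0 < Re (q x)" using that r1 unfolding r_def by auto
      then show ?thesis using y0 that by (auto simp: Y_def)
    qed
    show "y = Y x" if c: "(x, y) \<in> affine_curve a b" and d: "dist (x, y) (x0, y0) < r" for x y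
    proof -
      have "norm (y - y0) < norm y0"
        using d dist_snd_le[of "(x, y)" "(x0, y0)"] by (simp add: r_def dist_norm)
      then have "norm (y / y0 - 1) < 1"
        using y0 by (simp add: divide_simps norm_divide flip: norm_divide)
          (metis diff_divide_distrib divide_less_eq_1_pos divide_self_if norm_divide zero_less_norm_iff)
      then have "0 < Re (y / y0)"
        using abs_Re_le_cmod[of "y / y0 - 1"] by simp
      moreover have "(y / y0) ^ 2 = q x"
        using c by (simp add: q_def affine_curve_def power_divide)
      ultimately have "csqrt (q x) = y / y0"
        by (intro csqrt_unique) auto
      then show ?thesis using y0 by (simp add: Y_def)
    qed
  qed (rule Yder)
  then show thesis by (rule that)
qed

text \<open>Here \<open>x\<close> is a local chart, so the limit along the curve becomes an ordinary
  limit in the x-plane.\<close>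

lemma deriv_x_eqI:
  assumes Y: "local_branch a b x0 y0 r Y"
    and der: "((\<lambda>x. f (x, Y x)) has_field_derivative D) (at x0)"
  shows "deriv_x a b f (x0, y0) = D"
proof -
  note r = local_branchD(1)[OF Y] and Y0 = local_branchD(2)[OF Y]
    and curve = local_branchD(3)[OF Y] and uniq = local_branchD(6)[OF Y]
  have cont: "isCont Y x0"
    using local_branchD(5)[OF Y] r DERIV_isCont by force
  let ?F = "at (x0, y0) within affine_curve a b"
  have near: "\<forall>\<^sub>F q in ?F. fst q \<noteq> x0 \<and> q = (fst q, Y (fst q))"
    unfolding eventually_at
  proof (intro exI[of _ r] conjI r ballI impI)
    fix q assume "q \<in> affine_curve a b" and "q \<noteq> (x0, y0) \<and> dist q (x0, y0) < r"
    then have "snd q = Y (fst q)" "q \<noteq> (x0, y0)"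
      using uniq[of "fst q" "snd q"] by auto
    then show "fst q \<noteq> x0" "q = (fst q, Y (fst q))"
      using Y0 by (auto simp: prod_eq_iff)
  qed
  have "filterlim fst (at x0) ?F"
    unfolding filterlim_at
    using near by (auto intro!: tendsto_eq_intros elim: eventually_mono)
  then have "((\<lambda>q. (f (fst q, Y (fst q)) - f (x0, Y x0)) / (fst q - x0)) \<longlongrightarrow> D) ?F"
    using filterlim_compose der unfolding has_field_derivative_iff by blast
  then have lim: "((\<lambda>q. (f q - f (x0, y0)) / (fst q - fst (x0, y0))) \<longlongrightarrow> D) ?F"
    by (rule Lim_transform_eventually) (use near in eventually_elim, use Y0 in auto)
  have param: "filterlim (\<lambda>x. (x, Y x)) ?F (at x0)"
    unfolding filterlim_at
  proof
    have "\<forall>\<^sub>F x in at x0. x \<in> ball x0 r \<and> x \<noteq> x0"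
      using r by (metis UNIV_I centre_in_ball eventually_at_in_open' eventually_conj
          eventually_neq_at_within open_ball)
    then show "\<forall>\<^sub>F x in at x0. (x, Y x) \<in> affine_curve a b \<and> (x, Y x) \<noteq> (x0, y0)"
      by eventually_elim (use curve in auto)
    show "((\<lambda>x. (x, Y x)) \<longlongrightarrow> (x0, y0)) (at x0)"
      using cont Y0 by (auto intro!: tendsto_Pair simp: isCont_def)
  qed
  \<comment> \<open>\<open>Lim\<close> is determined by convergence only along a nontrivial filter;
    the branch supplies curve points tending to \<open>(x0, y0)\<close>.\<close>
  have "?F \<noteq> bot"
  proof
    assume "?F = bot"
    then have "\<forall>\<^sub>F q in ?F. False" by simp
    then have "\<forall>\<^sub>F x in at x0. False"
      by (rule eventually_compose_filterlim[OF _ param])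
    then show False by (simp add: eventually_False)
  qed
  then show ?thesis
    unfolding deriv_x_def using lim by (rule tendsto_Lim)
qed

text \<open>By \<open>Y' = Q' / (2 Y)\<close> and \<open>Y^2 = Q\<close>, quotients of a polynomial
  by a multiple of a power of \<open>y\<close> are closed under differentiation. Keeping
  \<open>c'\<close> and \<open>m'\<close> as variables lets later denominators be plain
  numerals.\<close>

lemma quotient_has_field_derivative:
  assumes Y: "(Y has_field_derivative (3 * x0 ^ 2 + a) / (2 * y0)) (at x0)" "Y x0 = y0"
    and y0: "y0 ^ 2 = cubic a b x0" "y0 \<noteq> 0" and c: "c \<noteq> 0" "c' = 2 * c" "m' = m + 2"
  shows "((\<lambda>x. poly N x / (c * Y x ^ m)) has_field_derivative
    (2 * poly (pderiv N) x0 * cubic a b x0 - of_nat m * poly N x0 * (3 * x0 ^ 2 + a))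
      / (c' * y0 ^ m')) (at x0)"
proof -
  let ?D = "(poly (pderiv N) x0 * (c * y0 ^ m)
      - poly N x0 * (c * (of_nat m * y0 ^ (m - 1) * ((3 * x0 ^ 2 + a) / (2 * y0)))))
        / ((c * y0 ^ m) * (c * y0 ^ m))"
  have D: "(A * (c * w) - B * (c * (w / y0 * (k / (2 * y0))))) / ((c * w) * (c * w))
      = (2 * A * y0 ^ 2 - B * k) / (2 * c * (w * y0 ^ 2))" if "w \<noteq> 0" for A B k w :: complex
    using that y0(2) c by (simp add: divide_simps power2_eq_square) (simp add: algebra_simps)
  \<comment> \<open>This removes the truncated subtraction; for \<open>m = 0\<close> the factor
    \<open>of_nat m\<close> annihilates both sides.\<close>
  have "of_nat m * y0 ^ (m - 1) = of_nat m * (y0 ^ m / y0)"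
    using y0(2) by (cases m) simp_all
  then have "?D = (2 * poly (pderiv N) x0 * y0 ^ 2 - of_nat m * poly N x0 * (3 * x0 ^ 2 + a))
      / (c' * y0 ^ m')"
    using D[of "y0 ^ m" "poly (pderiv N) x0" "poly N x0" "of_nat m * (3 * x0 ^ 2 + a)"] y0(2)
    unfolding c by (simp add: power_add power2_eq_square mult_ac)
  moreover have "((\<lambda>x. poly N x / (c * Y x ^ m)) has_field_derivative ?D) (at x0)"
    using y0(2) c Y(2) by (auto intro!: derivative_eq_intros Y(1) simp: mult_ac)
  ultimately show ?thesis
    unfolding y0(1) by simp
qed

lemma deriv_x_quotient:
  assumes p: "(x0, y0) \<in> affine_curve a b" "y0 \<noteq> 0" and c: "c \<noteq> 0"
    and f: "\<And>x y. (x, y) \<in> affine_curve a b \<Longrightarrow> y \<noteq> 0 \<Longrightarrow> f (x, y) = poly N x / (c * y ^ m)"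
    and c': "c' = 2 * c" and m': "m' = m + 2"
  shows "deriv_x a b f (x0, y0) =
    (2 * poly (pderiv N) x0 * cubic a b x0 - of_nat m * poly N x0 * (3 * x0 ^ 2 + a))
      / (c' * y0 ^ m')" (is "_ = ?D")
proof -
  obtain r Y where Y: "local_branch a b x0 y0 r Y"
    using local_branch_exists[OF p] by blast
  have "((\<lambda>x. poly N x / (c * Y x ^ m)) has_field_derivative ?D) (at x0)"
    using p local_branchD(1,2)[OF Y] local_branchD(5)[OF Y, of x0]
    by (intro quotient_has_field_derivative c c' m') (simp_all add: affine_curve_def)
  then have "((\<lambda>x. f (x, Y x)) has_field_derivative ?D) (at x0)"
    by (rule has_field_derivative_transform_within_open[where S = "ball x0 r"])
      (use local_branchD(1)[OF Y] in \<open>simp_all add: f local_branchD(3,4)[OF Y]\<close>)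
  then show ?thesis
    by (rule deriv_x_eqI[OF Y])
qed

section \<open>The Riccati recursion up to order four\<close>

text \<open>Compare coefficients at index \<open>Suc k\<close>: \<open>fps_X\<close> shifts the
  derivative of \<open>s k\<close> there, and the two extreme terms of the convolution each give
  \<open>y * s (Suc k)\<close>, whence the factor 2.\<close>

lemma riccati_step:
  assumes "riccati_solution a b s" "(x, y) \<in> affine_curve a b" "y \<noteq> 0"
  shows "s 0 (x, y) = y"
    and "2 * y * s (Suc k) (x, y) = - deriv_x a b (s k) (x, y)
      - (\<Sum>i = 1..k. s i (x, y) * s (Suc k - i) (x, y))"
proof -
  let ?S = "Abs_fps (\<lambda>k. s k (x, y))" and ?D = "Abs_fps (\<lambda>k. deriv_x a b (s k) (x, y))"
  have s0: "s 0 (x, y) = y" and eq: "fps_const (cubic a b x) = fps_X * ?D + ?S ^ 2"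
    using assms unfolding riccati_solution_def by auto
  show "s 0 (x, y) = y" by (fact s0)
  have "0 = fps_nth (fps_const (cubic a b x)) (Suc k)"
    by simp
  also have "\<dots> = deriv_x a b (s k) (x, y) + (\<Sum>i = 0..Suc k. s i (x, y) * s (Suc k - i) (x, y))"
    unfolding eq by (simp add: power2_eq_square fps_mult_nth[of ?S ?S])
  also have "(\<Sum>i = 0..Suc k. s i (x, y) * s (Suc k - i) (x, y))
      = 2 * y * s (Suc k) (x, y) + (\<Sum>i = 1..k. s i (x, y) * s (Suc k - i) (x, y))"
    by (simp add: sum.atLeast_Suc_atMost s0 mult_ac)
  finally show "2 * y * s (Suc k) (x, y) = - deriv_x a b (s k) (x, y)
      - (\<Sum>i = 1..k. s i (x, y) * s (Suc k - i) (x, y))"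
    by (simp only: eq_diff_eq minus_equation_iff eq_neg_iff_add_eq_0 add_ac)
qed

context
  fixes a b :: complex and s :: "nat \<Rightarrow> complex \<times> complex \<Rightarrow> complex"
  assumes ric: "riccati_solution a b s"
begin

lemma riccati_1:
  assumes "(x, y) \<in> affine_curve a b" "y \<noteq> 0"
  shows "s 1 (x, y) = poly [:- a, 0, - 3:] x / (4 * y ^ 2)"
proof -
  have y: "y ^ 2 = cubic a b x" if "(x, y) \<in> affine_curve a b" for x y
    using that by (simp add: affine_curve_def)
  have N: "poly [:b, a, 0, 1:] x = cubic a b x" "poly (pderiv [:b, a, 0, 1:]) x = 3 * x ^ 2 + a" for x
    by (simp_all add: cubic_def pderiv_pCons algebra_simps eval_nat_numeral)
  \<comment> \<open>Writing \<open>y\<close> as \<open>Q / y\<close> brings \<open>s 0\<close> into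
    the quotient form that \<open>deriv_x_quotient\<close> expects.\<close>
  have "s 0 (x, y) = poly [:b, a, 0, 1:] x / (1 * y ^ 1)"
    if "(x, y) \<in> affine_curve a b" "y \<noteq> 0" for x y
    using riccati_step(1)[OF ric that] that(2)
    unfolding N y[OF that(1), symmetric] by (simp add: power2_eq_square)
  from deriv_x_quotient[where f = "s 0" and c' = 2 and m' = 3, OF assms _ this]
  have "deriv_x a b (s 0) (x, y) = (3 * x ^ 2 + a) * cubic a b x / (2 * y ^ 3)"
    unfolding N by (simp add: algebra_simps eval_nat_numeral)
  also have "\<dots> = (3 * x ^ 2 + a) / (2 * y)"
    using assms(2) unfolding y[OF assms(1), symmetric] by (simp add: eval_nat_numeral)
  finally have "2 * y * s 1 (x, y) = - ((3 * x ^ 2 + a) / (2 * y))"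
    using riccati_step(2)[OF ric assms, of 0] by simp
  then have "s 1 (x, y) = - ((3 * x ^ 2 + a) / (2 * y)) / (2 * y)"
    using assms(2) by (simp only: eq_divide_eq) (simp add: mult_ac)
  also have "- (P / (2 * y)) / (2 * y) = - P / (4 * y ^ 2)" for P
    by (simp add: power2_eq_square)
  also have "- (3 * x ^ 2 + a) = poly [:- a, 0, - 3:] x"
    by (simp add: power2_eq_square)
  finally show ?thesis .
qed

text \<open>The exponent 3k - 1 reproduces itself: the derivative raises it to 3k + 1, each product
  \<open>s i * s (Suc k - i)\<close> has (3i - 1) + (3(k + 1 - i) - 1) = 3k + 1 as well, and solving
  for \<open>s (Suc k)\<close> divides by \<open>2 * y\<close>.\<close>

lemma riccati_2:
  assumes "(x, y) \<in> affine_curve a b" "y \<noteq> 0"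
  shows "s 2 (x, y) = poly [:- 5 * a ^ 2, 24 * b, - 6 * a, 0, - 21:] x / (32 * y ^ 5)"
proof -
  let ?A = "poly [:- a, 0, - 3:] x"
  let ?D = "2 * poly (pderiv [:- a, 0, - 3:]) x * cubic a b x - of_nat 2 * ?A * (3 * x ^ 2 + a)"
  have der: "deriv_x a b (s 1) (x, y) = ?D / (8 * y ^ 4)"
    by (rule deriv_x_quotient[where f = "s 1", OF assms _ riccati_1]) simp_all
  have N: "- (2 * ?D + ?A * ?A) = poly [:- 5 * a ^ 2, 24 * b, - 6 * a, 0, - 21:] x"
    by (simp add: pderiv_pCons cubic_def algebra_simps eval_nat_numeral)
  \<comment> \<open>With \<open>S\<close>, \<open>A\<close>, \<open>D\<close> arbitrary, the
    division by powers of \<open>y\<close> is separated from the expansion of the polynomials, which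
    is left to \<open>N\<close>.\<close>
  have solve: "S = (- (2 * D + A * A)) / (32 * y ^ 5)"
    if "2 * y * S = - (D / (8 * y ^ 4)) - A / (4 * y ^ 2) * (A / (4 * y ^ 2))"
    for S A D
  proof -
    have "2 * y * S = (- (2 * D + A * A)) / (16 * y ^ 4)"
      unfolding that by (simp add: add_divide_distrib diff_divide_distrib flip: power_add)
    then have "S = (- (2 * D + A * A)) / (16 * y ^ 4) / (2 * y)"
      using assms(2) by (simp only: eq_divide_eq) (simp add: mult_ac)
    then show ?thesis by (simp add: mult_ac flip: power_Suc)
  qed
  have rec: "2 * y * s 2 (x, y) = - deriv_x a b (s 1) (x, y) - s 1 (x, y) * s 1 (x, y)"
    using riccati_step(2)[OF ric assms, of 1] by (simp add: eval_nat_numeral)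
  show ?thesis
    using solve[OF rec[unfolded der riccati_1[OF assms]]] unfolding N .
qed

lemma riccati_3:
  assumes "(x, y) \<in> affine_curve a b" "y \<noteq> 0"
  shows "s 3 (x, y) = poly [:- 30 * a ^ 3 - 48 * b ^ 2, 120 * a * b, - 102 * a ^ 2, 552 * b,
      - 42 * a, 0, - 210:] x / (128 * y ^ 8)"
proof -
  let ?A = "poly [:- a, 0, - 3:] x"
  let ?B = "poly [:- 5 * a ^ 2, 24 * b, - 6 * a, 0, - 21:] x"
  let ?D = "2 * poly (pderiv [:- 5 * a ^ 2, 24 * b, - 6 * a, 0, - 21:]) x * cubic a b x
    - of_nat 5 * ?B * (3 * x ^ 2 + a)"
  have der: "deriv_x a b (s 2) (x, y) = ?D / (64 * y ^ 7)"
    by (rule deriv_x_quotient[where f = "s 2", OF assms _ riccati_2]) simp_all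
  have N: "- (?D + ?A * ?B) = poly [:- 30 * a ^ 3 - 48 * b ^ 2, 120 * a * b, - 102 * a ^ 2, 552 * b,
      - 42 * a, 0, - 210:] x"
    by (simp add: pderiv_pCons cubic_def algebra_simps eval_nat_numeral)
  have solve: "S = (- (D + A * B)) / (128 * y ^ 8)"
    if "2 * y * S = - (D / (64 * y ^ 7)) - 2 * (A / (4 * y ^ 2) * (B / (32 * y ^ 5)))"
    for S A B D
  proof -
    have "2 * y * S = (- (D + A * B)) / (64 * y ^ 7)"
      unfolding that by (simp add: add_divide_distrib diff_divide_distrib flip: power_add)
    then have "S = (- (D + A * B)) / (64 * y ^ 7) / (2 * y)"
      using assms(2) by (simp only: eq_divide_eq) (simp add: mult_ac)
    then show ?thesis by (simp add: mult_ac flip: power_Suc)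
  qed
  have rec: "2 * y * s 3 (x, y) = - deriv_x a b (s 2) (x, y) - 2 * (s 1 (x, y) * s 2 (x, y))"
    using riccati_step(2)[OF ric assms, of 2] by (simp add: eval_nat_numeral)
  show ?thesis
    using solve[OF rec[unfolded der riccati_1[OF assms] riccati_2[OF assms]]] unfolding N .
qed

lemma riccati_4:
  assumes "(x, y) \<in> affine_curve a b" "y \<noteq> 0"
  shows "s 4 (x, y) = poly (fourth_numerator a b) x / (2048 * y ^ 11)"
proof -
  let ?A = "poly [:- a, 0, - 3:] x"
  let ?B = "poly [:- 5 * a ^ 2, 24 * b, - 6 * a, 0, - 21:] x"
  let ?p = "[:- 30 * a ^ 3 - 48 * b ^ 2, 120 * a * b, - 102 * a ^ 2, 552 * b,
      - 42 * a, 0, - 210:]"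
  let ?C = "poly ?p x"
  let ?D = "2 * poly (pderiv ?p) x * cubic a b x
    - of_nat 8 * ?C * (3 * x ^ 2 + a)"
  have der: "deriv_x a b (s 3) (x, y) = ?D / (256 * y ^ 10)"
    by (rule deriv_x_quotient[where f = "s 3", OF assms _ riccati_3]) simp_all
  \<comment> \<open>The weights 4, 4, 1 come from the common denominator
    \<open>1024 * y ^ 10\<close> of the derivative, the doubled product of \<open>s 1\<close> and
    \<open>s 3\<close>, and the square of \<open>s 2\<close>.\<close>
  have N: "- (4 * ?D + 4 * ?A * ?C + ?B * ?B) = poly (fourth_numerator a b) x"
    by (simp add: fourth_numerator_def pderiv_pCons cubic_def algebra_simps eval_nat_numeral)
  have solve: "S = (- (4 * D + 4 * A * C + B * B)) / (2048 * y ^ 11)"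
    if "2 * y * S = - (D / (256 * y ^ 10)) - 2 * (A / (4 * y ^ 2) * (C / (128 * y ^ 8)))
      - B / (32 * y ^ 5) * (B / (32 * y ^ 5))"
    for S A B C D
  proof -
    have "2 * y * S = (- (4 * D + 4 * A * C + B * B)) / (1024 * y ^ 10)"
      unfolding that by (simp add: add_divide_distrib diff_divide_distrib flip: power_add)
    then have "S = (- (4 * D + 4 * A * C + B * B)) / (1024 * y ^ 10) / (2 * y)"
      using assms(2) by (simp only: eq_divide_eq) (simp add: mult_ac)
    then show ?thesis by (simp add: mult_ac flip: power_Suc)
  qed
  have rec: "2 * y * s 4 (x, y) = - deriv_x a b (s 3) (x, y)
      - 2 * (s 1 (x, y) * s 3 (x, y)) - s 2 (x, y) * s 2 (x, y)"
    using riccati_step(2)[OF ric assms, of 3] by (simp add: eval_nat_numeral)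
  show ?thesis
    using solve[OF rec[unfolded der riccati_1[OF assms] riccati_2[OF assms] riccati_3[OF assms]]]
    unfolding N .
qed

end

section \<open>Integration along paths avoiding the branch points\<close>

text \<open>At the finitely many parameters in \<open>S\<close> continuity of the primitive replaces
  differentiability.\<close>

lemma has_integral_along:
  fixes g :: "real \<Rightarrow> complex \<times> complex" and F :: "complex \<times> complex \<Rightarrow> complex"
  assumes "finite S" "0 \<le> u" "u \<le> v" "v \<le> 1"
    and D: "\<And>t. t \<in> {u<..<v} - S \<Longrightarrow> (fst \<circ> g has_vector_derivative D t) (at t)"
    and \<phi>: "\<And>t. t \<in> {u<..<v} - S \<Longrightarrow> (\<phi> has_vector_derivative F (g t) * D t) (at t)"
    and cont: "continuous_on {u..v} \<phi>"
  shows "((\<lambda>t. F (g t) * vector_derivative (fst \<circ> g) (at t within {0..1}))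
    has_integral \<phi> v - \<phi> u) {u..v}"
proof (rule fundamental_theorem_of_calculus_interior_strong[OF assms(1,3) _ cont])
  fix t assume t: "t \<in> {u<..<v} - S"
  \<comment> \<open>The definition of \<open>path_integral\<close> differentiates within
    \<open>{0..1}\<close>; at interior parameters this is the two-sided derivative.\<close>
  then have "at t within {0..1} = at t"
    using assms(2,4) by (intro at_within_interior) auto
  then show "(\<phi> has_vector_derivative F (g t) * vector_derivative (fst \<circ> g) (at t within {0..1})) (at t)"
    using \<phi>[OF t] D[OF t] by (simp add: vector_derivative_at)
qed

lemma valid_path_fst_derivative:
  assumes "valid_path g"
  obtains S D where "finite S" "\<And>t. t \<in> {0..1} - S \<Longrightarrow> (fst \<circ> g has_vector_derivative D t) (at t)"
proof -
  obtain S D where S: "finite S" and D: "\<And>t. t \<in> {0..1} - S \<Longrightarrow> (g has_vector_derivative D t) (at t)"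
    using assms unfolding valid_path_def piecewise_C1_differentiable_on_def C1_differentiable_on_def
    by blast
  have "(fst \<circ> g has_vector_derivative fst (D t)) (at t)" if "t \<in> {0..1} - S" for t
    unfolding o_def by (rule bounded_linear.has_vector_derivative[OF bounded_linear_fst D[OF that]])
  with S show thesis by (rule that)
qed

definition regular_path :: "complex \<Rightarrow> complex \<Rightarrow> (real \<Rightarrow> complex \<times> complex) \<Rightarrow> bool" where
  "regular_path a b g \<longleftrightarrow> valid_path g \<and> (\<forall>t\<in>{0..1}. g t \<in> affine_curve a b \<and> snd (g t) \<noteq> 0)"

text \<open>Continuity keeps nearby points of the path inside the neighbourhood where the curve is
  the graph of \<open>Y\<close>.\<close>

lemma regular_path_local_branch:
  assumes g: "regular_path a b g" and t: "t \<in> {0..1}"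
  obtains r Y d where "local_branch a b (fst (g t)) (snd (g t)) r Y" "0 < d"
    "\<forall>t'\<in>{0..1}. dist t' t < d \<longrightarrow>
      fst (g t') \<in> ball (fst (g t)) r \<and> snd (g t') = Y (fst (g t'))"
proof -
  have "(fst (g t), snd (g t)) \<in> affine_curve a b" "snd (g t) \<noteq> 0"
    using g t by (simp_all add: regular_path_def)
  then obtain r Y where Y: "local_branch a b (fst (g t)) (snd (g t)) r Y"
    using local_branch_exists by blast
  have "continuous_on {0..1} g"
    using g by (simp add: regular_path_def valid_path_def piecewise_C1_differentiable_on_def)
  then have "\<exists>d>0. \<forall>t'\<in>{0..1}. dist t' t < d \<longrightarrow> dist (g t') (g t) < r"
    using t local_branchD(1)[OF Y] unfolding continuous_on_iff by simp
  then obtain d where d: "d > 0" "\<forall>t'\<in>{0..1}. dist t' t < d \<longrightarrow> dist (g t') (g t) < r"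
    by blast
  have "fst (g t') \<in> ball (fst (g t)) r \<and> snd (g t') = Y (fst (g t'))"
    if "t' \<in> {0..1}" "dist t' t < d" for t'
  proof
    have near: "dist (g t') (g t) < r" using d that by blast
    then show "fst (g t') \<in> ball (fst (g t)) r"
      using dist_fst_le[of "g t'" "g t"] by (simp add: dist_commute)
    show "snd (g t') = Y (fst (g t'))"
      using local_branchD(6)[OF Y, of "fst (g t')" "snd (g t')"] g that near
      by (simp add: regular_path_def)
  qed
  then show thesis using that[OF Y d(1)] by blast
qed

text \<open>
  The derivative of a piecewise \<open>C\<^sup>1\<close> path may be unbounded near the exceptional parameters,
  so integrability is obtained from local primitives and the fundamental theorem of calculus.
\<close>
lemma regular_path_integrable:
  assumes g: "regular_path a b g" and P: "P holomorphic_on UNIV"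
  shows "(\<lambda>t. (\<lambda>(x, y). P x / y) (g t) * vector_derivative (fst \<circ> g) (at t within {0..1}))
    integrable_on {0..1}" (is "?f integrable_on _")
proof -
  obtain S D where S: "finite S"
    and D: "\<And>t. t \<in> {0..1} - S \<Longrightarrow> (fst \<circ> g has_vector_derivative D t) (at t)"
    using g valid_path_fst_derivative unfolding regular_path_def by metis
  have cont: "continuous_on {0..1} g"
    using g by (simp add: regular_path_def valid_path_def piecewise_C1_differentiable_on_def)
  have "\<exists>d>0. \<forall>u v. t \<in> cbox u v \<and> cbox u v \<subseteq> ball t d \<and> cbox u v \<subseteq> cbox 0 1 \<longrightarrow>
    ?f integrable_on cbox u v" if t: "t \<in> {0..1}" for t :: real
  proof -
    obtain r Y d where branch: "local_branch a b (fst (g t)) (snd (g t)) r Y" and d: "0 < d"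
      and near: "\<forall>t'\<in>{0..1}. dist t' t < d \<longrightarrow>
      fst (g t') \<in> ball (fst (g t)) r \<and> snd (g t') = Y (fst (g t'))"
      using regular_path_local_branch[OF g t] .
    note Y = local_branchD(4,5)[OF branch]
    have "Y holomorphic_on ball (fst (g t)) r"
      using Y(2) by (meson holomorphic_onI field_differentiable_at_within field_differentiable_def)
    then have "(\<lambda>x. P x / Y x) holomorphic_on ball (fst (g t)) r"
      using Y(1) P by (intro holomorphic_intros) (auto intro: holomorphic_on_subset)
    \<comment> \<open>A disc is convex, so the holomorphic function \<open>P / Y\<close> has a
      primitive on it.\<close>
    then obtain H where "\<forall>x\<in>ball (fst (g t)) r.
        (H has_field_derivative P x / Y x) (at x within ball (fst (g t)) r)"
    proof (rule holomorphic_convex_primitive'[OF convex_ball open_ball])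
      fix H assume "\<And>x. x \<in> ball (fst (g t)) r \<Longrightarrow>
        (H has_field_derivative P x / Y x) (at x within ball (fst (g t)) r)"
      then show thesis by (intro that[of H] ballI)
    qed
    then have H: "(H has_field_derivative P x / Y x) (at x)" if "x \<in> ball (fst (g t)) r" for x
      using that at_within_open[OF that open_ball] by metis
    show ?thesis
    proof (intro exI[of _ d] conjI d allI impI)
      fix u v assume "t \<in> cbox u v \<and> cbox u v \<subseteq> ball t d \<and> cbox u v \<subseteq> cbox 0 (1::real)"
      then have tuv: "u \<le> t" "t \<le> v" and ball: "{u..v} \<subseteq> ball t d" and sub: "{u..v} \<subseteq> {0..1}"
        by auto
      have in01: "t' \<in> {0..1}" "dist t' t < d" if "t' \<in> {u..v}" for t'
        using that ball sub by (auto simp: dist_commute)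
      have "(?f has_integral (H \<circ> (fst \<circ> g)) v - (H \<circ> (fst \<circ> g)) u) {u..v}"
      proof (rule has_integral_along[OF S])
        show "0 \<le> u" "u \<le> v" "v \<le> 1" using sub tuv by auto
        fix t' assume "t' \<in> {u<..<v} - S"
        then have t': "t' \<in> {u..v}" "t' \<notin> S" by auto
        show fd: "(fst \<circ> g has_vector_derivative D t') (at t')"
          using in01[OF t'(1)] t'(2) by (intro D) auto
        have "((H \<circ> (fst \<circ> g)) has_vector_derivative D t' * (P (fst (g t')) / Y (fst (g t')))) (at t')"
          using near in01[OF t'(1)] by (intro field_vector_diff_chain_at fd) (simp add: H)
        then show "((H \<circ> (fst \<circ> g)) has_vector_derivative
            (case g t' of (x, y) \<Rightarrow> P x / y) * D t') (at t')"
          using near in01[OF t'(1)] by (simp add: case_prod_unfold mult_ac)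
      next
        have "continuous_on (ball (fst (g t)) r) H"
          using H by (meson DERIV_isCont continuous_at_imp_continuous_on)
        moreover have "continuous_on {u..v} (fst \<circ> g)"
          unfolding o_def using cont sub by (auto intro!: continuous_intros intro: continuous_on_subset)
        moreover have "(fst \<circ> g) ` {u..v} \<subseteq> ball (fst (g t)) r"
        proof (rule image_subsetI)
          fix t' assume "t' \<in> {u..v}"
          then show "(fst \<circ> g) t' \<in> ball (fst (g t)) r"
            using near in01[of t'] by simp
        qed
        ultimately show "continuous_on {u..v} (H \<circ> (fst \<circ> g))"
          by (meson continuous_on_compose continuous_on_subset)
      qed
      then show "?f integrable_on cbox u v" by auto
    qed
  qed
  \<comment> \<open>Integrability glues from small subintervals; the primitives \<open>H\<close> are
    never glued, so their monodromy is irrelevant.\<close>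
  then have "?f integrable_on cbox 0 1"
    by (intro integrable_on_little_subintervals ballI) simp
  then show ?thesis by simp
qed

text \<open>Unlike the forms in \<open>regular_path_integrable\<close>, this one has a primitive
  defined on the whole curve off \<open>y = 0\<close>. Branches serve only to differentiate it, and
  the fundamental theorem applies on \<open>{0..1}\<close> at once.\<close>

lemma regular_path_exact:
  assumes g: "regular_path a b g" and c: "c \<noteq> 0" "c' = 2 * c" "m' = m + 2"
  shows "((\<lambda>t. (\<lambda>(x, y). (2 * poly (pderiv N) x * cubic a b x
        - of_nat m * poly N x * (3 * x ^ 2 + a)) / (c' * y ^ m')) (g t) * vector_derivative (fst \<circ> g) (at t within {0..1}))
    has_integral (\<lambda>(x, y). poly N x / (c * y ^ m)) (g 1)
      - (\<lambda>(x, y). poly N x / (c * y ^ m)) (g 0)) {0..1}"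
proof -
  obtain S D where S: "finite S"
    and D: "\<And>t. t \<in> {0..1} - S \<Longrightarrow> (fst \<circ> g has_vector_derivative D t) (at t)"
    using g valid_path_fst_derivative unfolding regular_path_def by metis
  have cont: "continuous_on {0..1} g"
    using g by (simp add: regular_path_def valid_path_def piecewise_C1_differentiable_on_def)
  have reg: "snd (g t) ^ 2 = cubic a b (fst (g t))" "snd (g t) \<noteq> 0" if "t \<in> {0..1}" for t
    using g that by (auto simp: regular_path_def affine_curve_def case_prod_unfold)
  let ?\<phi> = "\<lambda>t. poly N (fst (g t)) / (c * snd (g t) ^ m)"
  have "((\<lambda>t. (\<lambda>(x, y). (2 * poly (pderiv N) x * cubic a b x
        - of_nat m * poly N x * (3 * x ^ 2 + a)) / (c' * y ^ m')) (g t) * vector_derivative (fst \<circ> g) (at t within {0..1}))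
    has_integral ?\<phi> 1 - ?\<phi> 0) {0..1}"
  proof (rule has_integral_along[OF S])
    fix t :: real assume t: "t \<in> {0<..<1} - S"
    then have t01: "t \<in> {0..1}" by auto
    show fd: "(fst \<circ> g has_vector_derivative D t) (at t)"
      using t by (intro D) auto
    obtain r Y d where branch: "local_branch a b (fst (g t)) (snd (g t)) r Y" and d: "0 < d"
      and near: "\<forall>t'\<in>{0..1}. dist t' t < d \<longrightarrow>
      fst (g t') \<in> ball (fst (g t)) r \<and> snd (g t') = Y (fst (g t'))"
      using regular_path_local_branch[OF g t01] .
    let ?Q = "\<lambda>x. poly N x / (c * Y x ^ m)"
    let ?E = "(2 * poly (pderiv N) (fst (g t)) * cubic a b (fst (g t))
      - of_nat m * poly N (fst (g t)) * (3 * fst (g t) ^ 2 + a)) / (c' * snd (g t) ^ m')"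
    have "(?Q has_field_derivative ?E) (at ((fst \<circ> g) t))"
      unfolding o_apply
      using local_branchD(1,2)[OF branch] local_branchD(5)[OF branch, of "fst (g t)"]
      by (intro quotient_has_field_derivative reg[OF t01] c) auto
    then have "(?Q \<circ> (fst \<circ> g) has_vector_derivative D t * ?E) (at t)"
      by (rule field_vector_diff_chain_at[OF fd])
    then have "(?\<phi> has_vector_derivative D t * ?E) (at t)"
    proof (rule has_vector_derivative_transform_within_open)
      show "open ({0<..<1} \<inter> ball t d)" "t \<in> {0<..<1} \<inter> ball t d"
        using t d by auto
    qed (use near in \<open>simp add: dist_commute\<close>)
    then show "(?\<phi> has_vector_derivative
      (case g t of (x, y) \<Rightarrow>
        (2 * poly (pderiv N) x * cubic a b x
        - of_nat m * poly N x * (3 * x ^ 2 + a)) / (c' * y ^ m')) * D t) (at t)"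
      by (simp add: case_prod_unfold mult_ac)
  next
    show "continuous_on {0..1} ?\<phi>"
      using cont reg c(1) by (auto intro!: continuous_intros)
  qed auto
  then show ?thesis by (simp add: case_prod_unfold)
qed

section \<open>Cancellation of endpoint values over a cycle\<close>

lemma sum_keys_superset:
  assumes "finite K" "Poly_Mapping.keys c \<subseteq> K"
  shows "(\<Sum>f\<in>Poly_Mapping.keys c. of_int (Poly_Mapping.lookup c f) * w f)
    = (\<Sum>f\<in>K. of_int (Poly_Mapping.lookup c f) * (w f :: 'b :: ring_1))"
  using assms by (intro sum.mono_neutral_left) (auto simp: in_keys_iff)

lemma sum_keys_cmul_diff:
  fixes w :: "'a \<Rightarrow> 'b :: comm_ring_1"
  defines "L \<equiv> \<lambda>c. \<Sum>f\<in>Poly_Mapping.keys c. of_int (Poly_Mapping.lookup c f) * w f"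
  shows "L (\<Sum>i\<in>I. frag_cmul (k i) (frag_of (u i) - frag_of (v i)))
    = (\<Sum>i\<in>I. of_int (k i) * (w (u i) - w (v i)))"
proof -
  \<comment> \<open>Coefficients may cancel in \<open>c + d\<close>, so all three sums are taken
    over the union of the key sets.\<close>
  have add: "L (c + d) = L c + L d" for c d
  proof -
    let ?K = "Poly_Mapping.keys c \<union> Poly_Mapping.keys d"
    have L: "L e = (\<Sum>f\<in>?K. of_int (Poly_Mapping.lookup e f) * w f)"
      if "Poly_Mapping.keys e \<subseteq> ?K" for e
      unfolding L_def by (rule sum_keys_superset) (use that in auto)
    have "L (c + d) = (\<Sum>f\<in>?K. of_int (Poly_Mapping.lookup (c + d) f) * w f)"
      by (rule L) (rule keys_add)
    then show ?thesis
      by (simp add: L lookup_add distrib_right sum.distrib)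
  qed
  have single: "L (frag_cmul k (frag_of u - frag_of v)) = of_int k * (w u - w v)" for k u v
  proof -
    have "Poly_Mapping.keys (frag_cmul k (frag_of u - frag_of v)) \<subseteq> {u, v}"
      using keys_diff[of "frag_of u" "frag_of v"] by (auto simp: keys_frag_of)
    then have "L (frag_cmul k (frag_of u - frag_of v))
        = (\<Sum>f\<in>{u, v}. of_int (Poly_Mapping.lookup (frag_cmul k (frag_of u - frag_of v)) f) * w f)"
      unfolding L_def by (intro sum_keys_superset) auto
    then show ?thesis
      by (cases "u = v") (auto simp: lookup_minus lookup_single algebra_simps)
  qed
  show ?thesis
  proof (induction I rule: infinite_finite_induct)
    case (insert i I)
    then show ?case by (simp add: add single)
  qed (simp_all add: L_def)
qed

text \<open>\<open>simplex_param 0\<close> plays two roles: vertex 0 of the 1-simplex and the only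
  point of the 0-simplex. Face 0 omits vertex 0 and therefore hits the endpoint at parameter
  1.\<close>

lemma simplex_param_face:
  "simplical_face 0 (simplex_param 0) = simplex_param 1"
  "simplical_face 1 (simplex_param 0) = simplex_param 0"
  by (auto simp: simplical_face_def simplex_param_def fun_eq_iff)

text \<open>The sum is the additive extension of \<open>w\<close>, read as a function of
  0-simplices, evaluated on the boundary of \<open>c\<close>. Hence \<open>w\<close> may be any
  function at all.\<close>

lemma cycle_sum_endpoints:
  fixes w :: "'a \<Rightarrow> 'b :: comm_ring_1"
  assumes "chain_boundary 1 c = 0"
  shows "(\<Sum>f\<in>Poly_Mapping.keys c. of_int (Poly_Mapping.lookup c f)
    * (w (f (simplex_param 1)) - w (f (simplex_param 0)))) = 0"
proof -
  have s0: "simplex_param 0 \<in> standard_simplex 0"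
    by (auto simp: simplex_param_def standard_simplex_def)
  have face: "singular_face 1 0 f (simplex_param 0) = f (simplex_param 1)"
    "singular_face 1 1 f (simplex_param 0) = f (simplex_param 0)" for f :: "(nat \<Rightarrow> real) \<Rightarrow> 'a"
    using s0 simplex_param_face by (simp_all add: singular_face_def)
  have "(\<Sum>f\<in>Poly_Mapping.keys c. frag_cmul (Poly_Mapping.lookup c f)
      (frag_of (singular_face 1 0 f) - frag_of (singular_face 1 1 f))) = 0"
    using assms by (simp add: chain_boundary_def frag_extend_def)
  from arg_cong[OF this, of
      "\<lambda>c. \<Sum>\<sigma>\<in>Poly_Mapping.keys c. of_int (Poly_Mapping.lookup c \<sigma>)
        * w (\<sigma> (simplex_param 0))"]
  show ?thesis
    unfolding sum_keys_cmul_diff face by simp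
qed

section \<open>From homology classes to the fourth-order period\<close>

lemma representative_cycle:
  assumes "\<gamma> \<in> carrier (homology_group 1 X)" "c \<in> \<gamma>"
  shows "singular_chain 1 X c" "chain_boundary 1 c = 0"
proof -
  obtain d where d: "singular_relcycle 1 X {} d" "homologous_rel 1 X {} d c"
    using assms carrier_relative_homology_group[of 1 X "{}"] by auto
  then have "singular_relcycle 1 X {} c"
    by (metis homologous_rel_singular_relcycle)
  then show "singular_chain 1 X c" "chain_boundary 1 c = 0"
    by (simp_all add: singular_cycle)
qed

lemma simplex_path_regular:
  assumes c: "singular_chain 1 (elliptic_curve a b) c" "integration_chain c"
    and f: "f \<in> Poly_Mapping.keys c"
  shows "regular_path a b (simplex_path f)"
proof -
  have "simplex_path f t \<in> affine_curve a b" if t: "t \<in> {0..1}" for t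
  proof -
    have "singular_simplex 1 (elliptic_curve a b) f"
      using c(1) f by (auto simp: singular_chain_def)
    then have "f ` standard_simplex 1 \<subseteq> topspace (elliptic_curve a b)"
      by (auto simp: singular_simplex_def continuous_map_def)
    moreover have "simplex_param t \<in> standard_simplex 1"
      using t by (auto simp: simplex_param_def standard_simplex_def)
    ultimately have "f (simplex_param t) \<in> topspace (elliptic_curve a b)" by blast
    \<comment> \<open>Away from \<open>None\<close>, \<open>the\<close> in
      \<open>simplex_path\<close> returns the actual curve point.\<close>
    moreover have "f (simplex_param t) \<noteq> None"
      using c(2) f t by (auto simp: integration_chain_def)
    ultimately show ?thesis
      by (auto simp: elliptic_curve_def simplex_path_def)
  qed
  then show ?thesis
    using c(2) f by (auto simp: regular_path_def integration_chain_def)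
qed

lemma fourth_period_on_path:
  assumes disc: "cubic_disc a b \<noteq> 0" and ric: "riccati_solution a b s"
    and \<alpha>: "cubic_disc a b ^ 3 * \<alpha> = - (63 / 640) * a * b * (788 * a ^ 3 - 2457 * b ^ 2)"
    and \<beta>: "cubic_disc a b ^ 3 * \<beta> = - (21 / 320) * a ^ 2 * (308 * a ^ 3 - 5697 * b ^ 2)"
    and g: "regular_path a b g"
  defines "\<Phi> \<equiv> \<lambda>(x, y). poly (exact_numerator a b) x / (46080 * cubic_disc a b ^ 3 * y ^ 9)"
  shows "path_integral (s 4) g = \<alpha> * path_integral (\<lambda>(x, y). 1 / y) g
    + \<beta> * path_integral (\<lambda>(x, y). x / y) g + (\<Phi> (g 1) - \<Phi> (g 0))"
proof -
  let ?\<Delta> = "cubic_disc a b" and ?M = "exact_numerator a b"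
  let ?E = "\<lambda>(x, y). (2 * poly (pderiv ?M) x * cubic a b x - of_nat 9 * poly ?M x * (3 * x ^ 2 + a))
    / (92160 * ?\<Delta> ^ 3 * y ^ 11)"
  let ?v = "\<lambda>t. vector_derivative (fst \<circ> g) (at t within {0..1})"
  have s4: "s 4 (x, y) = \<alpha> * (1 / y) + \<beta> * (x / y) + ?E (x, y)"
    if p: "(x, y) \<in> affine_curve a b" "y \<noteq> 0" for x y
  proof -
    have y2: "cubic a b x = y ^ 2" using p by (simp add: affine_curve_def)
    let ?c = "[:9072 * (a * b * (788 * a ^ 3 - 2457 * b ^ 2)),
        6048 * (a ^ 2 * (308 * a ^ 3 - 5697 * b ^ 2)):]"
    have "poly ([:45 * ?\<Delta> ^ 3:] * fourth_numerator a b) x =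
        - poly ?c x * poly [:b, a, 0, 1:] x ^ 5
        + 2 * poly (pderiv ?M) x * poly [:b, a, 0, 1:] x - 9 * poly ?M x * poly [:a, 0, 3:] x"
      unfolding exact_numerator_identity
      by (simp only: poly_mult poly_add poly_diff poly_minus poly_power poly_numeral)
    moreover have "poly ([:45 * ?\<Delta> ^ 3:] * fourth_numerator a b) x
        = 45 * ?\<Delta> ^ 3 * poly (fourth_numerator a b) x"
      by simp
    moreover have "poly [:b, a, 0, 1:] x = cubic a b x" "poly [:a, 0, 3:] x = 3 * x ^ 2 + a"
      by (simp_all add: cubic_def algebra_simps eval_nat_numeral)
    moreover have "- poly ?c x = 92160 * ?\<Delta> ^ 3 * (\<alpha> + \<beta> * x)"
    proof -
      have "92160 * ?\<Delta> ^ 3 * (\<alpha> + \<beta> * x)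
          = 92160 * (?\<Delta> ^ 3 * \<alpha>) + 92160 * (?\<Delta> ^ 3 * \<beta>) * x"
        by (simp add: algebra_simps)
      then show ?thesis unfolding \<alpha> \<beta> by simp
    qed
    ultimately have key: "45 * ?\<Delta> ^ 3 * poly (fourth_numerator a b) x =
      92160 * ?\<Delta> ^ 3 * (\<alpha> + \<beta> * x) * cubic a b x ^ 5
      + (2 * poly (pderiv ?M) x * cubic a b x - of_nat 9 * poly ?M x * (3 * x ^ 2 + a))"
      by (simp only: of_nat_numeral add_diff_eq)
    \<comment> \<open>Expanding by \<open>45 * ?\<Delta> ^ 3\<close> is where the nonvanishing
      discriminant enters; \<open>key\<close> then splits the numerator.\<close>
    have "s 4 (x, y) = (45 * ?\<Delta> ^ 3 * poly (fourth_numerator a b) x) / (92160 * ?\<Delta> ^ 3 * y ^ 11)"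
      unfolding riccati_4[OF ric p] using disc by simp
    also have "\<dots> = (\<alpha> + \<beta> * x) * (y ^ 10 / y ^ 11) + ?E (x, y)"
      unfolding key using disc by (simp add: y2 add_divide_distrib flip: power_mult)
    also have "y ^ 10 / y ^ 11 = 1 / y"
      using p by (simp add: eval_nat_numeral)
    finally show ?thesis by (simp add: add_divide_distrib distrib_right)
  qed
  \<comment> \<open>\<open>integral\<close> is 0 by default for a non-integrable function, so
    linearity needs the existence of both basic integrals.\<close>
  have I: "((\<lambda>t. (\<lambda>(x, y). P x / y) (g t) * ?v t) has_integral path_integral (\<lambda>(x, y). P x / y) g) {0..1}"
    if "P holomorphic_on UNIV" for P
    unfolding path_integral_def using regular_path_integrable[OF g that] by (rule integrable_integral)
  have "((\<lambda>t. ?E (g t) * ?v t) has_integral (\<Phi> (g 1) - \<Phi> (g 0))) {0..1}"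
    unfolding \<Phi>_def by (rule regular_path_exact[OF g]) (use disc in simp_all)
  then have "((\<lambda>t. \<alpha> * ((\<lambda>(x, y). 1 / y) (g t) * ?v t) + \<beta> * ((\<lambda>(x, y). x / y) (g t) * ?v t)
      + ?E (g t) * ?v t) has_integral \<alpha> * path_integral (\<lambda>(x, y). 1 / y) g
    + \<beta> * path_integral (\<lambda>(x, y). x / y) g + (\<Phi> (g 1) - \<Phi> (g 0))) {0..1}"
    using I[of "\<lambda>x. 1"] I[of "\<lambda>x. x"] by (intro has_integral_add has_integral_mult_right) auto
  then have "((\<lambda>t. s 4 (g t) * ?v t) has_integral \<alpha> * path_integral (\<lambda>(x, y). 1 / y) g
    + \<beta> * path_integral (\<lambda>(x, y). x / y) g + (\<Phi> (g 1) - \<Phi> (g 0))) {0..1}"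
  proof (rule has_integral_eq[rotated])
    fix t :: real assume "t \<in> {0..1}"
    moreover obtain x y where gt: "g t = (x, y)" by fastforce
    ultimately have p: "(x, y) \<in> affine_curve a b" "y \<noteq> 0"
      using g by (force simp: regular_path_def)+
    then show "\<alpha> * ((\<lambda>(x, y). 1 / y) (g t) * ?v t) + \<beta> * ((\<lambda>(x, y). x / y) (g t) * ?v t)
      + ?E (g t) * ?v t = s 4 (g t) * ?v t"
      unfolding gt s4[OF p] by (simp only: prod.case distrib_right mult.assoc)
  qed
  then show ?thesis
    unfolding path_integral_def by (rule integral_unique)
qed

theorem mainTheorem12:
  fixes a b \<alpha> \<beta> :: complex
    and s :: "nat \<Rightarrow> complex \<times> complex \<Rightarrow> complex"
  assumes "cubic_disc a b \<noteq> 0"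
    and "riccati_solution a b s"
    and "cubic_disc a b ^ 3 * \<alpha> = - (63 / 640) * a * b * (788 * a ^ 3 - 2457 * b ^ 2)"
    and "cubic_disc a b ^ 3 * \<beta> = - (21 / 320) * a ^ 2 * (308 * a ^ 3 - 5697 * b ^ 2)"
  shows "\<forall>\<gamma> \<in> carrier (homology_group 1 (elliptic_curve a b)). \<forall>c \<in> representatives \<gamma>.
           chain_integral (s 4) c =
             \<alpha> * chain_integral (\<lambda>(x, y). 1 / y) c + \<beta> * chain_integral (\<lambda>(x, y). x / y) c
           \<and> (b = 0 \<longrightarrow>
                chain_integral (s 4) c =
                  - (1617 / 5120) * a powi (- 4) * chain_integral (\<lambda>(x, y). x / y) c)"
proof (intro ballI)
  fix \<gamma> c
  assume \<gamma>: "\<gamma> \<in> carrier (homology_group 1 (elliptic_curve a b))" and c: "c \<in> representatives \<gamma>"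
  let ?\<Phi> = "\<lambda>(x, y). poly (exact_numerator a b) x / (46080 * cubic_disc a b ^ 3 * y ^ 9)"
  let ?A = "chain_integral (\<lambda>(x, y). 1 / y) c" and ?B = "chain_integral (\<lambda>(x, y). x / y) c"
  have cyc: "singular_chain 1 (elliptic_curve a b) c" "chain_boundary 1 c = 0" and ic: "integration_chain c"
    using representative_cycle[OF \<gamma>] c by (auto simp: representatives_def)
  have "chain_integral (s 4) c = (\<Sum>f\<in>Poly_Mapping.keys c. of_int (Poly_Mapping.lookup c f)
    * (\<alpha> * path_integral (\<lambda>(x, y). 1 / y) (simplex_path f)
      + \<beta> * path_integral (\<lambda>(x, y). x / y) (simplex_path f)
      + (?\<Phi> (simplex_path f 1) - ?\<Phi> (simplex_path f 0))))"
    unfolding chain_integral_def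
    by (intro sum.cong refl arg_cong2[where f = "(*)"] fourth_period_on_path assms
        simplex_path_regular[OF cyc(1) ic])
  also have "\<dots> = \<alpha> * ?A + \<beta> * ?B + (\<Sum>f\<in>Poly_Mapping.keys c. of_int (Poly_Mapping.lookup c f)
    * (?\<Phi> (simplex_path f 1) - ?\<Phi> (simplex_path f 0)))"
    unfolding chain_integral_def
    by (simp add: distrib_left sum.distrib sum_distrib_left mult_ac)
  also have "(\<Sum>f\<in>Poly_Mapping.keys c. of_int (Poly_Mapping.lookup c f)
    * (?\<Phi> (simplex_path f 1) - ?\<Phi> (simplex_path f 0))) = 0"
    \<comment> \<open>\<open>w\<close> lives on the compactified curve; whatever value it takes at
      \<open>None\<close> does no harm, since the cancellation holds for every function.\<close>
    unfolding simplex_path_def by (rule cycle_sum_endpoints[where w = "\<lambda>p. ?\<Phi> (the p)", OF cyc(2)])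
  finally have main: "chain_integral (s 4) c = \<alpha> * ?A + \<beta> * ?B" by simp
  moreover have "chain_integral (s 4) c = - (1617 / 5120) * a powi (- 4) * ?B" if b: "b = 0"
  proof -
    have a: "a \<noteq> 0" using assms(1) b by (auto simp: cubic_disc_def)
    have "\<alpha> = 0" using assms(1,3) b by simp
    moreover have "\<beta> = - (1617 / 5120) * a powi (- 4)"
    proof -
      \<comment> \<open>For \<open>b = 0\<close> the cube is \<open>64 * a ^ 9\<close>; splitting
        off \<open>a ^ 5\<close>, the power on the right of the equation for \<beta>, leaves 21 *
        308 / 320 = 1617 / 80 after cancellation.\<close>
      have "cubic_disc a b ^ 3 = a ^ 5 * (64 * a ^ 4)"
        by (simp add: b cubic_disc_def eval_nat_numeral)
      then have "a ^ 5 * (64 * a ^ 4 * \<beta>) = - (21 / 320) * a ^ 2 * (308 * a ^ 3)"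
        using assms(4) by (simp add: b mult.assoc)
      also have "\<dots> = a ^ 5 * (- (1617 / 80))"
        by (simp add: eval_nat_numeral)
      finally have "a ^ 5 * (64 * a ^ 4 * \<beta>) = a ^ 5 * (- (1617 / 80))" .
      then have "64 * a ^ 4 * \<beta> = - (1617 / 80)"
        by (rule mult_left_cancel[THEN iffD1, rotated]) (use a in simp)
      then show ?thesis using a by (simp add: power_int_minus field_simps)
    qed
    ultimately show ?thesis using main by simp
  qed
  ultimately show "chain_integral (s 4) c = \<alpha> * ?A + \<beta> * ?B \<and>
      (b = 0 \<longrightarrow> chain_integral (s 4) c = - (1617 / 5120) * a powi (- 4) * ?B)"
    by blast
qed

end
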